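(* Let $d\ge 1$. There exist a compact set $X\in\mathcal{K}$ and a dense subset $D\subset X$ such that $\mathrm{Tan}(X,x)=\mathcal{K}_0$ for all $x\in D$.
   Context: $Q=[-1,1]^d\subset\mathbb{R}^d$, $\mathcal{K}$ is the collection of all non-empty compact subsets of $Q$ with the Hausdorff metric $d_H$, and $\mathcal{K}_0=\{K\in\mathcal{K}:0\in K\}$. For $E\in\mathcal{K}$, $x\in E$, $t>0$, put $T_{x,t}(E)=\{(y-x)/t:y\in E\}\cap Q$. A set $F\in\mathcal{K}$ is a tangent set of $E$ at $x\in E$ if there is a sequence $t_n\searrow 0$ with $d_H(T_{x,t_n}(E),F)\to 0$; $\mathrm{Tan}(E,x)$ is the collection of all tangent sets of $E$ at $x$. *)

theory Defs
  imports "HOL-Analysis.Analysis"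
begin

text \<open>The dimension \<open>d \<ge> 1\<close> is \<open>CARD('n)\<close> for an arbitrary finite type \<open>'n\<close>;
  distances are Euclidean.\<close>

definition unit_cube :: "(real ^ 'n) set"
  where "unit_cube = cbox (\<chi> i. -1) (\<chi> i. 1)"

definition compacts :: "(real ^ 'n) set set"
  where "compacts = {K. K \<noteq> {} \<and> compact K \<and> K \<subseteq> unit_cube}"

definition compacts0 :: "(real ^ 'n) set set"
  where "compacts0 = {K \<in> compacts. 0 \<in> K}"

text \<open>Meaningful for non-empty bounded \<open>A\<close> and \<open>B\<close> only: the supremum of an empty or
  unbounded set of reals is unspecified.\<close>

definition hausdorff_dist :: "'a::metric_space set \<Rightarrow> 'a set \<Rightarrow> real"
  where "hausdorff_dist A B = max (SUP a\<in>A. infdist a B) (SUP b\<in>B. infdist b A)"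

definition rescale :: "real ^ 'n \<Rightarrow> real \<Rightarrow> (real ^ 'n) set \<Rightarrow> (real ^ 'n) set"
  where "rescale x t E = {(y - x) /\<^sub>R t |y. y \<in> E} \<inter> unit_cube"

text \<open>For \<open>E \<in> compacts\<close>, \<open>x \<in> E\<close> and \<open>t > 0\<close> the set \<open>rescale x t E\<close> is again in
  \<open>compacts\<close> (it contains \<open>0\<close>), so \<open>hausdorff_dist\<close> is only applied where it is
  meaningful. Convergence \<open>t\<^sub>n \<searrow> 0\<close> is read as: positive, non-increasing, with limit \<open>0\<close>.
  Passing to a subsequence shows that asking for strict decrease gives the same sets.\<close>

definition Tan :: "(real ^ 'n) set \<Rightarrow> real ^ 'n \<Rightarrow> (real ^ 'n) set set"
  where "Tan E x = {F \<in> compacts. \<exists>t :: nat \<Rightarrow> real.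
    (\<forall>n. t n > 0) \<and> decseq t \<and> t \<longlonglongrightarrow> 0 \<and>
    (\<lambda>n. hausdorff_dist (rescale x (t n) E) F) \<longlonglongrightarrow> 0}"

end

theory Submission
  imports Defs "HOL-Real_Asymp.Real_Asymp"
begin

text \<open>Let \<open>F\<^sub>0, F\<^sub>1, \<dots>\<close> list a countable dense family of finite sets of \<open>compacts0\<close>, each infinitely
  often. Put \<open>X\<^sub>0 = {0}\<close> and \<open>X\<^sub>n\<^sub>+\<^sub>1 = X\<^sub>n + t\<^sub>n F\<^sub>n\<close>, where \<open>t\<^sub>n\<close> is small compared both with the distances
  between points of the finite set \<open>X\<^sub>n\<close> and with \<open>t\<^sub>n\<^sub>-\<^sub>1\<close>. Take for \<open>D\<close> the union of the \<open>X\<^sub>n\<close> and for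
  \<open>X\<close> its closure. Seen from \<open>x \<in> X\<^sub>n\<close> at scale \<open>t\<^sub>n\<close>, the other points of \<open>X\<^sub>n\<close> are out of sight and
  the later stages perturb the picture \<open>F\<^sub>n\<close> only slightly. As \<open>X\<^sub>n\<close> increases with \<open>n\<close>, every point
  of \<open>D\<close> sees almost all the \<open>F\<^sub>n\<close>.\<close>

section \<open>Comparing sets in the Hausdorff distance\<close>

text \<open>A form of Hausdorff distance at most \<open>e\<close> free of suprema: its triangle
  inequality holds with no nonemptiness or boundedness condition.\<close>

definition hausdorff_close :: "real \<Rightarrow> 'a::metric_space set \<Rightarrow> 'a set \<Rightarrow> bool"
  where "hausdorff_close e A B \<longleftrightarrow>
    (\<forall>a\<in>A. \<exists>b\<in>B. dist a b \<le> e) \<and> (\<forall>b\<in>B. \<exists>a\<in>A. dist a b \<le> e)"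

lemma hausdorff_close_trans:
  assumes "hausdorff_close d A B" "hausdorff_close e B C"
  shows "hausdorff_close (d + e) A C"
proof -
  have *: "dist a c \<le> d + e" if "dist a b \<le> d" "dist b c \<le> e" for a b c :: 'a
    using that dist_triangle[of a c b] by linarith
  show ?thesis
    using assms unfolding hausdorff_close_def by (meson *)
qed

lemma hausdorff_dist_le:
  assumes "hausdorff_close e A B" "A \<noteq> {}" "B \<noteq> {}"
  shows "hausdorff_dist A B \<le> e"
proof -
  have "infdist a B \<le> e" if "a \<in> A" for a
    using assms that unfolding hausdorff_close_def by (meson infdist_le2)
  moreover have "infdist b A \<le> e" if "b \<in> B" for b
    using assms that unfolding hausdorff_close_def by (metis dist_commute infdist_le2)
  ultimately show ?thesis
    unfolding hausdorff_dist_def using assms by (simp add: cSUP_least)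
qed

text \<open>Boundedness makes the supremum over \<open>A\<close> a genuine upper bound; the other
  supremum can only raise the maximum.\<close>

lemma infdist_le_hausdorff_dist:
  assumes "bounded A" "B \<noteq> {}" "a \<in> A"
  shows "infdist a B \<le> hausdorff_dist A B"
proof -
  obtain b where "b \<in> B" using assms by blast
  obtain M where M: "\<And>x. x \<in> A \<Longrightarrow> dist b x \<le> M"
    using assms(1) unfolding bounded_any_center[where a = b] by blast
  have "infdist x B \<le> M" if "x \<in> A" for x
    using infdist_le2[OF \<open>b \<in> B\<close>, of x M] M[OF that] by (simp add: dist_commute)
  then have "bdd_above ((\<lambda>x. infdist x B) ` A)" by (rule bdd_aboveI2)
  then show ?thesis
    unfolding hausdorff_dist_def using cSUP_upper[OF assms(3)] by (meson le_max_iff_disj)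
qed

lemma hausdorff_dist_nonneg:
  assumes "bounded A" "A \<noteq> {}" "B \<noteq> {}"
  shows "0 \<le> hausdorff_dist A B"
  using assms by (meson all_not_in_conv infdist_le_hausdorff_dist infdist_nonneg order_trans)

section \<open>The cube, rescalings, and why tangent sets contain 0\<close>

lemma mem_unit_cube: "x \<in> unit_cube \<longleftrightarrow> (\<forall>i. \<bar>x $ i\<bar> \<le> 1)"
  unfolding unit_cube_def mem_box_cart by (auto simp: abs_le_iff minus_le_iff)

lemma norm_unit_cube_le:
  fixes x :: "real ^ 'n"
  assumes "x \<in> unit_cube"
  shows "norm x \<le> real CARD('n)"
proof -
  have "norm x \<le> (\<Sum>i\<in>UNIV. \<bar>x $ i\<bar>)" by (rule norm_le_l1_cart)
  also have "\<dots> \<le> (\<Sum>i\<in>(UNIV :: 'n set). 1)"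
    using assms by (intro sum_mono) (simp add: mem_unit_cube)
  finally show ?thesis by simp
qed

lemma bounded_rescale: "bounded (rescale x t E)"
  unfolding rescale_def unit_cube_def by (meson bounded_cbox bounded_subset inf_le2)

lemma zero_in_rescale:
  assumes "x \<in> E"
  shows "0 \<in> rescale x t E"
  using assms unfolding rescale_def by (force simp: mem_unit_cube)

text \<open>Every rescaling at \<open>x\<close> contains 0, so the distance from 0 to
  \<open>F\<close> is bounded by Hausdorff distances tending to 0; as \<open>F\<close> is closed, it
  contains 0.\<close>

lemma Tan_subset_compacts0:
  assumes "x \<in> E"
  shows "Tan E x \<subseteq> compacts0"
proof
  fix F assume "F \<in> Tan E x"
  then obtain t where F: "F \<in> compacts"
    and t: "(\<lambda>n. hausdorff_dist (rescale x (t n) E) F) \<longlonglongrightarrow> 0"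
    unfolding Tan_def by blast
  have ne: "F \<noteq> {}" and cl: "closed F"
    using F by (auto simp: compacts_def compact_imp_closed)
  have "infdist 0 F \<le> hausdorff_dist (rescale x (t n) E) F" for n
    using assms ne by (intro infdist_le_hausdorff_dist bounded_rescale zero_in_rescale)
  then have "infdist 0 F \<le> 0" using LIMSEQ_le_const[OF t] by blast
  then have "infdist 0 F = 0" using infdist_nonneg by (metis order_antisym)
  then have "0 \<in> F" using cl ne by (simp add: in_closed_iff_infdist_zero)
  then show "F \<in> compacts0" using F by (simp add: compacts0_def)
qed

section \<open>A dense sequence of finite sets\<close>

text \<open>Take a finite \<open>e/2\<close>-net of \<open>K\<close> and move each centre by less
  than \<open>e/2\<close> into \<open>P\<close>. The extra point \<open>a\<close> lies in
  \<open>K\<close>, so adding it costs nothing.\<close>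

lemma finite_approximation:
  fixes K :: "'a::metric_space set"
  assumes "compact K" "K \<subseteq> closure P" "a \<in> K" "e > 0"
  obtains A where "finite A" "A \<subseteq> insert a P" "a \<in> A" "hausdorff_close e A K"
proof -
  obtain C where C: "finite C" "C \<subseteq> K" "K \<subseteq> (\<Union>c\<in>C. ball c (e/2))"
    using seq_compact_imp_totally_bounded[OF compact_imp_seq_compact[OF assms(1)]] assms(4)
    by (meson half_gt_zero)
  have "\<exists>p\<in>P. dist p c < e/2" if "c \<in> C" for c
    using that C(2) assms(2,4) closure_approachable[of c P] by (meson half_gt_zero subsetD)
  then obtain p where p: "\<And>c. c \<in> C \<Longrightarrow> p c \<in> P \<and> dist (p c) c < e/2" by metis
  show ?thesis
  proof
    show "finite (insert a (p ` C))" "insert a (p ` C) \<subseteq> insert a P" "a \<in> insert a (p ` C)"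
      using C p by auto
    have "\<exists>x\<in>K. dist b x \<le> e" if b: "b \<in> insert a (p ` C)" for b
    proof (cases "b = a")
      case True
      then show ?thesis using assms by (intro bexI[of _ a]) auto
    next
      case False
      then obtain c where c: "c \<in> C" "b = p c" using b by auto
      then have "dist b c < e/2" using p by simp
      then have "dist b c \<le> e" using assms(4) by linarith
      then show ?thesis using c C(2) by blast
    qed
    moreover have "\<exists>b\<in>insert a (p ` C). dist b x \<le> e" if x: "x \<in> K" for x
    proof -
      obtain c where c: "c \<in> C" "dist c x < e/2" using x C(3) by auto
      then have "dist (p c) x \<le> e"
        using p[of c] dist_triangle[of "p c" x c] by linarith
      then show ?thesis using c by blast
    qed
    ultimately show "hausdorff_close e (insert a (p ` C)) K"
      unfolding hausdorff_close_def by blast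
  qed
qed

lemma dense_sequence_compacts0:
  obtains F :: "nat \<Rightarrow> (real ^ 'n) set"
  where "\<And>n. finite (F n)" "\<And>n. F n \<in> compacts0"
    "\<And>K e N. K \<in> compacts0 \<Longrightarrow> e > 0 \<Longrightarrow> \<exists>n\<ge>N. hausdorff_close e (F n) K"
proof -
  obtain P :: "(real ^ 'n) set" where P: "countable P" "P \<subseteq> unit_cube" "unit_cube \<subseteq> closure P"
    using separable by blast
  define \<A> where "\<A> = {A. A \<subseteq> insert 0 P \<and> finite A} \<inter> {A. 0 \<in> A}"
  have cnt: "countable \<A>"
    unfolding \<A>_def using P(1) countable_Collect_finite_subset[of "insert 0 P"]
    by (intro countable_Int1) (simp add: conj_commute)
  have "{0} \<in> \<A>" unfolding \<A>_def by simp
  then have ne: "\<A> \<noteq> {}" by blast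
  \<comment> \<open>the first component of \<open>prod_decode\<close> takes every value infinitely often\<close>
  define F where "F n = from_nat_into \<A> (fst (prod_decode n))" for n
  have F: "F n \<in> \<A>" for n unfolding F_def using ne by (rule from_nat_into)
  have "\<exists>n\<ge>N. hausdorff_close e (F n) K" if K: "K \<in> compacts0" and e: "e > 0" for K e N
  proof -
    have "compact K" "K \<subseteq> closure P" "0 \<in> K"
      using K P(3) by (auto simp: compacts0_def compacts_def)
    then obtain A where A: "A \<in> \<A>" "hausdorff_close e A K"
      using finite_approximation[OF _ _ _ e] unfolding \<A>_def by (metis (mono_tags, lifting) IntI mem_Collect_eq)
    obtain m where m: "A = from_nat_into \<A> m"
      using from_nat_into_surj[OF cnt A(1)] by metis
    \<comment> \<open>With \<open>N\<close> as second component the code is at least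
      \<open>N\<close>, so \<open>A\<close> recurs arbitrarily late.\<close>
    have "F (prod_encode (m, N)) = A" by (simp add: F_def m)
    then show ?thesis using A(2) le_prod_encode_2 by metis
  qed
  moreover have "F n \<in> compacts0" for n
    using F[of n] P(2) unfolding \<A>_def compacts0_def compacts_def
    by (auto simp: finite_imp_compact mem_unit_cube)
  moreover have "finite (F n)" for n using F[of n] by (simp add: \<A>_def)
  ultimately show ?thesis using that by blast
qed

section \<open>Scales, finite stages and their limit set\<close>

lemma finite_separated:
  fixes A :: "'a::metric_space set"
  assumes "finite A"
  obtains d where "d > 0" "\<And>x y. x \<in> A \<Longrightarrow> y \<in> A \<Longrightarrow> x \<noteq> y \<Longrightarrow> d \<le> dist x y"
proof -
  \<comment> \<open>The 1 keeps \<open>S\<close> nonempty when \<open>A\<close> has at most one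
    point.\<close>
  define S where "S = insert 1 ((\<lambda>(x, y). dist x y) ` {p \<in> A \<times> A. fst p \<noteq> snd p})"
  have fin: "finite S" unfolding S_def using assms by auto
  show ?thesis
  proof
    have "Min S \<in> S" using fin by (intro Min_in) (auto simp: S_def)
    then show "Min S > 0" by (auto simp: S_def)
    show "Min S \<le> dist x y" if "x \<in> A" "y \<in> A" "x \<noteq> y" for x y
      using fin that by (intro Min_le) (auto simp: S_def image_iff intro!: bexI[of _ "(x, y)"])
  qed
qed

text \<open>\<open>CARD('n)\<close> bounds the norm on the cube, and the separation beats three
  displacements of that size at scale \<open>t n\<close>. The divisor \<open>real n + 4\<close>
  exceeds 3, at least halves the scale, and makes later errors vanish relative to
  \<open>t n\<close>.\<close>

locale multiscale =
  fixes F :: "nat \<Rightarrow> (real ^ 'n) set"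
    and t :: "nat \<Rightarrow> real"
    and X :: "nat \<Rightarrow> (real ^ 'n) set"
  assumes F: "F n \<in> compacts0"
    and X_0: "X 0 = {0}"
    and X_Suc: "X (Suc n) = (\<Union>x\<in>X n. (\<lambda>f. x + t n *\<^sub>R f) ` F n)"
    and t_0: "t 0 = 1/2"
    and t_pos: "t n > 0"
    and t_Suc: "t (Suc n) \<le> t n / (real n + 4)"
    and separated: "x \<in> X n \<Longrightarrow> y \<in> X n \<Longrightarrow> x \<noteq> y \<Longrightarrow> 3 * real CARD('n) * t n \<le> dist x y"
begin

lemma t_Suc_le_half: "t (Suc n) \<le> t n / 2"
proof -
  have "t n / (real n + 4) \<le> t n / 2"
    using t_pos[of n] by (intro divide_left_mono) auto
  then show ?thesis using t_Suc[of n] by linarith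
qed

lemma decseq_t: "decseq t"
proof (rule decseq_SucI)
  show "t (Suc n) \<le> t n" for n using t_Suc_le_half[of n] t_pos[of n] by linarith
qed

lemma t_tendsto_0: "t \<longlonglongrightarrow> 0"
proof (rule Lim_null_comparison)
  have "t n \<le> (1/2) ^ n" for n
  proof (induction n)
    case (Suc n)
    then show ?case using t_Suc_le_half[of n] by simp
  qed (simp add: t_0)
  then show "\<forall>\<^sub>F n in sequentially. norm (t n) \<le> (1/2) ^ n"
    using t_pos by (intro always_eventually) (simp add: less_imp_le)
  show "(\<lambda>n. (1/2 :: real) ^ n) \<longlonglongrightarrow> 0" by (rule LIMSEQ_power_zero) simp
qed

lemma F_unit_cube: "f \<in> F n \<Longrightarrow> f \<in> unit_cube"
  using F[of n] by (auto simp: compacts0_def compacts_def)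

lemma zero_in_F: "0 \<in> F n"
  using F[of n] by (simp add: compacts0_def)

lemma incseq_X: "incseq X"
proof (rule incseq_SucI)
  show "X n \<subseteq> X (Suc n)" for n
    unfolding X_Suc using zero_in_F[of n] by force
qed

text \<open>The reserve \<open>2 * t n\<close> pays for all later moves: the next one shifts a
  coordinate by at most \<open>t n\<close>, and halving keeps \<open>2 * t (Suc n)\<close> below the
  remaining \<open>t n\<close>.\<close>

lemma X_margin: "x \<in> X n \<Longrightarrow> \<bar>x $ i\<bar> + 2 * t n \<le> 1"
proof (induction n arbitrary: x)
  case 0
  then show ?case by (simp add: X_0 t_0)
next
  case (Suc n)
  then obtain y f where y: "y \<in> X n" "f \<in> F n" "x = y + t n *\<^sub>R f" by (auto simp: X_Suc)
  have "\<bar>f $ i\<bar> \<le> 1" using F_unit_cube[OF y(2)] by (simp add: mem_unit_cube)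
  then have "\<bar>t n * f $ i\<bar> \<le> t n"
    using t_pos[of n] by (simp add: abs_mult mult_left_le)
  moreover have "\<bar>x $ i\<bar> \<le> \<bar>y $ i\<bar> + \<bar>t n * f $ i\<bar>" by (simp add: y(3) abs_triangle_ineq)
  ultimately show ?case using Suc.IH[OF y(1)] t_Suc_le_half[of n] by linarith
qed

lemma X_unit_cube: "X n \<subseteq> unit_cube"
proof
  fix x assume "x \<in> X n"
  then have "\<bar>x $ i\<bar> \<le> 1" for i using X_margin[of x n i] t_pos[of n] by linarith
  then show "x \<in> unit_cube" by (simp add: mem_unit_cube)
qed

text \<open>Subtracting \<open>t m\<close> lets the induction close: a step costs at most
  \<open>CARD('n) * t m\<close>, which by halving is covered by the growth of the bound.\<close>

lemma later_stage_near:
  assumes "n \<le> m" "z \<in> X m"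
  shows "\<exists>w\<in>X n. dist z w \<le> 2 * real CARD('n) * (t n - t m)"
  using assms
proof (induction m arbitrary: z rule: dec_induct)
  case base
  then show ?case by (intro bexI[of _ z]) auto
next
  case (step m)
  then obtain y f where y: "y \<in> X m" "f \<in> F m" "z = y + t m *\<^sub>R f" by (auto simp: X_Suc)
  obtain w where w: "w \<in> X n" "dist y w \<le> 2 * real CARD('n) * (t n - t m)" using step.IH[OF y(1)] by blast
  have "dist z y = t m * norm f" using t_pos[of m] by (simp add: y(3) dist_norm)
  also have "\<dots> \<le> t m * real CARD('n)"
    using t_pos[of m] norm_unit_cube_le[OF F_unit_cube[OF y(2)]] by simp
  finally have "dist z w \<le> real CARD('n) * t m + 2 * real CARD('n) * (t n - t m)"
    using w(2) dist_triangle[of z w y] by (simp add: mult.commute)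
  also have "\<dots> = real CARD('n) * (2 * t n - t m)" by (simp add: algebra_simps)
  also have "\<dots> \<le> real CARD('n) * (2 * (t n - t (Suc m)))"
    using t_Suc_le_half[of m] by (intro mult_left_mono) auto
  finally show ?case using w(1) by (auto simp: algebra_simps)
qed

text \<open>Two multiples of \<open>CARD('n) * t n\<close> come from the later stages, the third
  from approximating a closure point by a stage point.\<close>

lemma closure_near:
  assumes "y \<in> closure (\<Union>m. X m)"
  shows "\<exists>w\<in>X n. dist y w \<le> 3 * real CARD('n) * t n"
proof -
  have "real CARD('n) * t n > 0" using t_pos[of n] by simp
  then obtain z m where z: "z \<in> X m" "dist z y < real CARD('n) * t n"
    using assms unfolding closure_approachable by blast
  have "z \<in> X (max n m)" using z(1) incseqD[OF incseq_X, of m "max n m"] by auto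
  then obtain w where w: "w \<in> X n" "dist z w \<le> 2 * real CARD('n) * (t n - t (max n m))"
    using later_stage_near[of n "max n m"] by auto
  have "2 * real CARD('n) * (t n - t (max n m)) \<le> 2 * real CARD('n) * t n"
    using t_pos[of "max n m"] by (intro mult_left_mono) auto
  then have "dist y w \<le> 3 * real CARD('n) * t n"
    using w(2) z(2) dist_triangle3[of y w z] by linarith
  then show ?thesis using w(1) by blast
qed

text \<open>Stage \<open>Suc n\<close> consists of copies of \<open>t n *\<^sub>R F n\<close> around
  points of \<open>X n\<close>, and the window at \<open>x\<close> sees only the copy at
  \<open>x\<close>. The reverse direction is exact, since that copy lies in the limit set.\<close>

lemma rescale_close:
  assumes "x \<in> X n"
  shows "hausdorff_close (3 * real CARD('n) / (real n + 4)) (rescale x (t n) (closure (\<Union>m. X m))) (F n)"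
proof -
  let ?R = "real CARD('n)" and ?X = "closure (\<Union>m. X m)"
  have "\<exists>f\<in>F n. dist u f \<le> 3 * ?R / (real n + 4)" if u: "u \<in> rescale x (t n) ?X" for u
  proof -
    obtain y where y: "y \<in> ?X" "u = (y - x) /\<^sub>R t n" and uQ: "u \<in> unit_cube"
      using u unfolding rescale_def by blast
    have y_eq: "y = x + t n *\<^sub>R u" using y(2) t_pos[of n] by simp
    \<comment> \<open>Stage \<open>Suc n\<close> rather than \<open>n\<close>: the error must be
      small compared with \<open>t n\<close>.\<close>
    obtain w where w: "w \<in> X (Suc n)" "dist y w \<le> 3 * ?R * t (Suc n)"
      using closure_near[OF y(1), of "Suc n"] by blast
    obtain x' f where x': "x' \<in> X n" and f: "f \<in> F n" and w_eq: "w = x' + t n *\<^sub>R f"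
      using w(1) by (auto simp: X_Suc)
    have "3 * ?R * t (Suc n) \<le> 3 * ?R * (t n / (real n + 4))"
      using t_Suc[of n] by (intro mult_left_mono) auto
    then have near: "dist y w \<le> t n * (3 * ?R / (real n + 4))" using w(2) by (simp add: ac_simps)
    \<comment> \<open>\<open>x\<close> and \<open>x'\<close> are too close to be different points of \<open>X n\<close>\<close>
    have "dist x x' < 3 * ?R * t n"
    proof -
      \<comment> \<open>Strict because \<open>real n + 4\<close> exceeds 3; the other two bounds are
        not, so this one makes the sum strictly less than the separation.\<close>
      have "t n * (3 * ?R / (real n + 4)) < t n * ?R"
        using t_pos[of n] by (intro mult_strict_left_mono) (auto simp: divide_simps)
      moreover have "dist x y \<le> t n * ?R"
        using t_pos[of n] norm_unit_cube_le[OF uQ] by (simp add: y_eq dist_norm)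
      moreover have "dist w x' \<le> t n * ?R"
        using t_pos[of n] norm_unit_cube_le[OF F_unit_cube[OF f]] by (simp add: w_eq dist_norm)
      moreover have "dist x x' \<le> dist x y + dist y w + dist w x'"
        using dist_triangle[of x x' y] dist_triangle[of y x' w] by linarith
      ultimately have "dist x x' < 3 * (t n * ?R)" using near by linarith
      then show ?thesis by (simp add: ac_simps)
    qed
    then have "x = x'" using separated[OF assms x'] by force
    then have "dist y w = t n * dist u f"
      using t_pos[of n] by (simp add: y_eq w_eq dist_norm flip: scaleR_diff_right)
    then have "dist u f \<le> 3 * ?R / (real n + 4)" using near t_pos[of n] by (simp only: mult_le_cancel_left_pos)
    then show ?thesis using f by blast
  qed
  moreover have "\<exists>u\<in>rescale x (t n) ?X. dist u f \<le> 3 * ?R / (real n + 4)" if f: "f \<in> F n" for f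
  proof (intro bexI)
    have "x + t n *\<^sub>R f \<in> X (Suc n)" using assms f by (auto simp: X_Suc)
    then have "x + t n *\<^sub>R f \<in> ?X" by (meson UN_I UNIV_I closure_subset subsetD)
    moreover have "f = (x + t n *\<^sub>R f - x) /\<^sub>R t n" using t_pos[of n] by simp
    ultimately show "f \<in> rescale x (t n) ?X"
      unfolding rescale_def using F_unit_cube[OF f] by blast
  qed simp
  ultimately show ?thesis unfolding hausdorff_close_def by blast
qed

text \<open>If \<open>x\<close> enters at stage \<open>k\<close>, every stage from \<open>k\<close>
  on contains it, so late indices with \<open>F\<close> close to \<open>K\<close> give scales at
  which the picture at \<open>x\<close> approaches \<open>K\<close>.\<close>

lemma compacts0_subset_Tan:
  assumes dense: "\<And>K e N. K \<in> compacts0 \<Longrightarrow> e > 0 \<Longrightarrow> \<exists>n\<ge>N. hausdorff_close e (F n) K"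
    and x: "x \<in> (\<Union>m. X m)"
  shows "compacts0 \<subseteq> Tan (closure (\<Union>m. X m)) x"
proof
  fix K :: "(real ^ 'n) set" assume K: "K \<in> compacts0"
  let ?X = "closure (\<Union>m. X m)"
  obtain k where k: "x \<in> X k" using x by blast
  have xX: "x \<in> ?X" by (rule subsetD[OF closure_subset x])
  have "\<exists>j. \<forall>n. (k \<le> j n \<and> hausdorff_close (1 / Suc n) (F (j n)) K) \<and> j n < j (Suc n)"
  proof (rule dependent_nat_choice)
    show "\<exists>j. k \<le> j \<and> hausdorff_close (1 / Suc 0) (F j) K" using dense[OF K] by simp
    show "\<exists>j'. (k \<le> j' \<and> hausdorff_close (1 / Suc (Suc n)) (F j') K) \<and> j < j'"
      if "k \<le> j \<and> hausdorff_close (1 / Suc n) (F j) K" for j n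
      \<comment> \<open>Searching from \<open>Suc j\<close> makes the indices strictly increase, so
        the scales form a subsequence of \<open>t\<close>.\<close>
      using dense[OF K, of "1 / Suc (Suc n)" "Suc j"] that
      by (metis Suc_le_eq divide_pos_pos le_trans less_imp_le of_nat_0_less_iff zero_less_Suc zero_less_one)
  qed
  then obtain j where kj: "\<And>n. k \<le> j n" and close: "\<And>n. hausdorff_close (1 / Suc n) (F (j n)) K"
    and j: "strict_mono j"
    unfolding strict_mono_Suc_iff by metis
  define e where "e n = 3 * real CARD('n) / (real n + 4)" for n
  have e: "e \<longlonglongrightarrow> 0" unfolding e_def by real_asymp
  have "hausdorff_close (e (j n) + 1 / Suc n) (rescale x (t (j n)) ?X) K" for n
    unfolding e_def using k incseqD[OF incseq_X kj]
    by (intro hausdorff_close_trans[OF rescale_close close]) blast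
  then have bound: "hausdorff_dist (rescale x (t (j n)) ?X) K \<le> e (j n) + 1 / Suc n" for n
    using K zero_in_rescale[OF xX] by (intro hausdorff_dist_le) (auto simp: compacts0_def)
  have nonneg: "0 \<le> hausdorff_dist (rescale x (t (j n)) ?X) K" for n
    using K zero_in_rescale[OF xX]
    by (intro hausdorff_dist_nonneg bounded_rescale) (auto simp: compacts0_def)
  have lim: "(\<lambda>n. hausdorff_dist (rescale x (t (j n)) ?X) K) \<longlonglongrightarrow> 0"
  proof (rule tendsto_sandwich)
    show "\<forall>\<^sub>F n in sequentially. 0 \<le> hausdorff_dist (rescale x (t (j n)) ?X) K"
      using nonneg by simp
    show "\<forall>\<^sub>F n in sequentially. hausdorff_dist (rescale x (t (j n)) ?X) K \<le> e (j n) + 1 / Suc n"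
      using bound by simp
    show "(\<lambda>n. e (j n) + 1 / Suc n) \<longlonglongrightarrow> 0"
      using tendsto_add[OF LIMSEQ_subseq_LIMSEQ[OF e j] LIMSEQ_Suc[OF lim_1_over_n]]
      by (simp add: comp_def)
  qed simp
  have "decseq (\<lambda>n. t (j n))"
    using decseq_t j by (auto simp: decseq_def strict_mono_less_eq)
  moreover have "(\<lambda>n. t (j n)) \<longlonglongrightarrow> 0"
    using LIMSEQ_subseq_LIMSEQ[OF t_tendsto_0 j] by (simp add: comp_def)
  ultimately show "K \<in> Tan ?X x"
    unfolding Tan_def using K t_pos lim
    by (auto simp: compacts0_def intro!: exI[of _ "\<lambda>n. t (j n)"])
qed

lemma closure_in_compacts: "closure (\<Union>m. X m) \<in> compacts"
proof -
  have "closure (\<Union>m. X m) \<subseteq> unit_cube"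
    using X_unit_cube by (intro closure_minimal) (auto simp: unit_cube_def closed_cbox)
  moreover from this have "compact (closure (\<Union>m. X m))"
    by (metis bounded_cbox bounded_subset closed_closure compact_eq_bounded_closed unit_cube_def)
  moreover have "X 0 \<noteq> {}" by (simp add: X_0)
  ultimately show ?thesis unfolding compacts_def by auto
qed

end

section \<open>Existence of the scales and stages\<close>

text \<open>Finite \<open>F n\<close> keep every stage finite, hence with a positive gap between its
  points, so a next scale exists. Scale and stage are chosen together as a pair.\<close>

lemma multiscale_exists:
  fixes F :: "nat \<Rightarrow> (real ^ 'n) set"
  assumes fin: "\<And>n. finite (F n)" and F: "\<And>n. F n \<in> compacts0"
  obtains t X where "multiscale F t X"
proof -
  let ?R = "real CARD('n)"
  let ?next = "\<lambda>n (s, A). \<Union>x\<in>A. (\<lambda>f. x + s *\<^sub>R f) ` F n"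
  \<comment> \<open>The clause for \<open>n = 0\<close> pins down the start, since dependent choice
    returns only a sequence satisfying the invariant.\<close>
  let ?inv = "\<lambda>n (s, A). (n = 0 \<longrightarrow> s = 1/2 \<and> A = {0}) \<and> finite A \<and> 0 < s \<and>
    (\<forall>x\<in>A. \<forall>y\<in>A. x \<noteq> y \<longrightarrow> 3 * ?R * s \<le> dist x y)"
  have "\<exists>p. \<forall>n. ?inv n (p n) \<and>
    (fst (p (Suc n)) \<le> fst (p n) / (real n + 4) \<and> snd (p (Suc n)) = ?next n (p n))"
  proof (rule dependent_nat_choice)
    show "\<exists>p. ?inv 0 p" by (rule exI[of _ "(1/2, {0})"]) auto
    show "\<exists>q. ?inv (Suc n) q \<and> (fst q \<le> fst p / (real n + 4) \<and> snd q = ?next n p)"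
      if "?inv n p" for p n
    proof -
      obtain s A where p: "p = (s, A)" by fastforce
      then have s: "s > 0" and A: "finite A" using that by auto
      define B where "B = ?next n p"
      have B: "finite B" using A fin by (simp add: B_def p)
      then obtain d where d: "d > 0" "\<And>x y. x \<in> B \<Longrightarrow> y \<in> B \<Longrightarrow> x \<noteq> y \<Longrightarrow> d \<le> dist x y"
        using finite_separated[OF B] by metis
      \<comment> \<open>The first bound gives the decay of the scales, the second the separation of
        \<open>B\<close>.\<close>
      define s' where "s' = min (s / (real n + 4)) (d / (3 * ?R))"
      have "s' > 0" using s d(1) by (simp add: s'_def)
      moreover have "3 * ?R * s' \<le> dist x y" if "x \<in> B" "y \<in> B" "x \<noteq> y" for x y
      proof -
        have "3 * ?R * s' \<le> 3 * ?R * (d / (3 * ?R))" unfolding s'_def by (intro mult_left_mono) auto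
        then show ?thesis using d(2)[OF that] by simp
      qed
      moreover have "s' \<le> s / (real n + 4)" by (simp add: s'_def)
      ultimately have "?inv (Suc n) (s', B) \<and> (fst (s', B) \<le> fst p / (real n + 4) \<and> snd (s', B) = ?next n p)"
        using B by (simp add: B_def p)
      then show ?thesis by (rule exI)
    qed
  qed
  then obtain p where "\<forall>n. ?inv n (p n) \<and>
      (fst (p (Suc n)) \<le> fst (p n) / (real n + 4) \<and> snd (p (Suc n)) = ?next n (p n))"
    by (rule exE)
  then have "?inv n (p n) \<and>
      (fst (p (Suc n)) \<le> fst (p n) / (real n + 4) \<and> snd (p (Suc n)) = ?next n (p n))" for n
    by (rule spec)
  note p = conjunct1[OF this] and p_Suc = conjunct2[OF this]
  have "multiscale F (\<lambda>n. fst (p n)) (\<lambda>n. snd (p n))"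
  proof
    show "snd (p 0) = {0}" "fst (p 0) = 1/2" using p[of 0] by (auto simp: case_prod_beta)
    show "F n \<in> compacts0" for n by (rule F)
    show "snd (p (Suc n)) = (\<Union>x\<in>snd (p n). (\<lambda>f. x + fst (p n) *\<^sub>R f) ` F n)"
      "fst (p (Suc n)) \<le> fst (p n) / (real n + 4)" for n
      using p_Suc[of n] by (auto simp: case_prod_beta)
    show "fst (p n) > 0" for n using p[of n] by (auto simp: case_prod_beta)
    show "3 * real CARD('n) * fst (p n) \<le> dist x y" if "x \<in> snd (p n)" "y \<in> snd (p n)" "x \<noteq> y" for x y n
      using p[of n] that by (auto simp: case_prod_beta)
  qed
  then show ?thesis by (rule that)
qed

section \<open>Tangent sets of the limit set\<close>

theorem theorem3p1:
  shows "\<exists>X D :: (real ^ 'n) set.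
    X \<in> compacts \<and> D \<subseteq> X \<and> X \<subseteq> closure D \<and> (\<forall>x\<in>D. Tan X x = compacts0)"
proof -
  obtain F :: "nat \<Rightarrow> (real ^ 'n) set"
    where fin: "\<And>n. finite (F n)" and F: "\<And>n. F n \<in> compacts0"
      and dense: "\<And>K e N. K \<in> compacts0 \<Longrightarrow> e > 0 \<Longrightarrow> \<exists>n\<ge>N. hausdorff_close e (F n) K"
    using that by (rule dense_sequence_compacts0)
  obtain t X where "multiscale F t X" by (rule multiscale_exists[OF fin F])
  then interpret multiscale F t X .
  let ?D = "\<Union>m. X m"
  have "Tan (closure ?D) x = compacts0" if "x \<in> ?D" for x
  proof (rule subset_antisym)
    show "Tan (closure ?D) x \<subseteq> compacts0"
      by (rule Tan_subset_compacts0[OF subsetD[OF closure_subset that]])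
    show "compacts0 \<subseteq> Tan (closure ?D) x"
      by (rule compacts0_subset_Tan[OF dense that])
  qed
  then show ?thesis
    using closure_in_compacts closure_subset by blast
qed

end
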